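(* Let $u\colon\mathbb{R}^3\to\mathbb{R}$ have octonion Fourier transform $U$. For $i=1,2,3$ let $V_i$ and $W_i$ denote the octonion Fourier transforms of $v_i(\mathbf{x})=-2\pi x_iu(\mathbf{x})$ and $w_i(\mathbf{x})=v_i(\mathbf{x})\cdot\mathbf{e}_{2^{i-1}}$, respectively. Then for all $(f_1,f_2,f_3)\in\mathbb{R}^3$ $$\begin{aligned} U_{f_1}(f_1,f_2,f_3)&=V_1(f_1,-f_2,-f_3)\cdot\mathbf{e}_1=W_1(f_1,f_2,f_3), \\ U_{f_2}(f_1,f_2,f_3)&=V_2(f_1,f_2,-f_3)\cdot\mathbf{e}_2=W_2(-f_1,f_2,f_3), \\ U_{f_3}(f_1,f_2,f_3)&=V_3(f_1,f_2,f_3)\cdot\mathbf{e}_4=W_3(-f_1,-f_2,f_3),\end{aligned}$$ where $U_{f_i}$ is the partial derivative of $U$ with respect to $f_i$.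
   Context: $\mathbb{O}$ denotes the real algebra of octonions with basis $1,\mathbf{e}_1,\dots,\mathbf{e}_7$: an octonion is a pair $(q_0,q_1)$ of quaternions (quaternion units $\mathbf{e}_1,\mathbf{e}_2,\mathbf{e}_3$ with $\mathbf{e}_1\mathbf{e}_2=\mathbf{e}_3$), with product $(q_0,q_1)\cdot(p_0,p_1)=(q_0p_0-p_1^*q_1,\;p_1q_0+q_1p_0^* )$, where $^*$ is quaternion conjugation, and $\mathbf{e}_4=(0,1)$, $\mathbf{e}_5=(0,\mathbf{e}_1)$, $\mathbf{e}_6=(0,\mathbf{e}_2)$, $\mathbf{e}_7=(0,\mathbf{e}_3)$. The product is neither commutative nor associative; products without brackets are evaluated from left to right, i.e. $abcd=((ab)c)d$. For an imaginary unit $\mathbf{e}_k$ and $\alpha\in\mathbb{R}$, $e^{\mathbf{e}_k\alpha}=\cos\alpha+\mathbf{e}_k\sin\alpha$. Integrals of octonion-valued functions are taken componentwise. The octonion Fourier transform (OFT) of a Lebesgue integrable $u\colon\mathbb{R}^3\to\mathbb{O}$ is $$U(\mathbf{f})=\int_{\mathbb{R}^3}u(\mathbf{x})\,e^{-\mathbf{e}_1 2\pi f_1x_1}\,e^{-\mathbf{e}_2 2\pi f_2x_2}\,e^{-\mathbf{e}_4 2\pi f_3x_3}\,d\mathbf{x},\qquad \mathbf{f}=(f_1,f_2,f_3)\in\mathbb{R}^3,$$ with multiplication from left to right. Partial derivatives of octonion-valued functions are taken componentwise with respect to the basis $1,\mathbf{e}_1,\dots,\mathbf{e}_7$. Standing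 assumptions: all considered derivatives and transforms exist; in particular $u$ and the functions $v_i$ are Lebesgue integrable. *)

theory Defs
  imports "HOL-Analysis.Analysis"
begin

text \<open>
  Quaternions and octonions are product types, so that addition, real scaling, norm, Bochner
  integral and vector derivative are the library ones on a Euclidean space; integrals of
  integrable functions and derivatives there agree with the componentwise ones.
\<close>

type_synonym quat = "real \<times> real \<times> real \<times> real"
type_synonym octonion = "quat \<times> quat"

fun quat_mult :: "quat \<Rightarrow> quat \<Rightarrow> quat" where
  "quat_mult (a0, a1, a2, a3) (b0, b1, b2, b3) =
    (a0 * b0 - a1 * b1 - a2 * b2 - a3 * b3,
     a0 * b1 + a1 * b0 + a2 * b3 - a3 * b2,
     a0 * b2 - a1 * b3 + a2 * b0 + a3 * b1,
     a0 * b3 + a1 * b2 - a2 * b1 + a3 * b0)"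

fun quat_cnj :: "quat \<Rightarrow> quat" where
  "quat_cnj (a0, a1, a2, a3) = (a0, - a1, - a2, - a3)"

text \<open>The product associates to the left, so unbracketed products are evaluated from left to right.\<close>

fun oct_mult :: "octonion \<Rightarrow> octonion \<Rightarrow> octonion" (infixl "\<odot>" 70) where
  "(q0, q1) \<odot> (p0, p1) =
    (quat_mult q0 p0 - quat_mult (quat_cnj p1) q1, quat_mult p1 q0 + quat_mult q1 (quat_cnj p0))"

text \<open>
  The basis elements for indices up to 3 (resp. 7); index 0 is the unit element, and larger
  indices give 0.
\<close>

definition quat_unit :: "nat \<Rightarrow> quat" where
  "quat_unit k = (of_bool (k = 0), of_bool (k = 1), of_bool (k = 2), of_bool (k = 3))"

definition oct_unit :: "nat \<Rightarrow> octonion" where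
  "oct_unit k = (if k < 4 then (quat_unit k, 0) else (0, quat_unit (k - 4)))"

definition oct_of_real :: "real \<Rightarrow> octonion" where
  "oct_of_real r = r *\<^sub>R oct_unit 0"

text \<open>\<open>oct_exp k a\<close> is the exponential of \<open>a\<close> times the imaginary unit with index \<open>k\<close>.\<close>

definition oct_exp :: "nat \<Rightarrow> real \<Rightarrow> octonion" where
  "oct_exp k a = oct_of_real (cos a) + sin a *\<^sub>R oct_unit k"

definition oft :: "(real ^ 3 \<Rightarrow> octonion) \<Rightarrow> real ^ 3 \<Rightarrow> octonion" where
  "oft u f = (\<integral>x. u x \<odot> oct_exp 1 (- (2 * pi * f $ 1 * x $ 1))
                      \<odot> oct_exp 2 (- (2 * pi * f $ 2 * x $ 2))
                      \<odot> oct_exp 4 (- (2 * pi * f $ 3 * x $ 3)) \<partial>lebesgue)"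

end

theory Submission imports Defs begin

text \<open>
  The transform of a real-valued \<open>u\<close> integrates \<open>u x\<close> against a product of three exponentials, a
  bounded smooth function of three angles of which the \<open>i\<close>-th is \<open>- 2 \<pi> f\<^sub>i x\<^sub>i\<close>. Differentiating with
  respect to \<open>f\<^sub>i\<close> brings down the factor \<open>- 2 \<pi> x\<^sub>i\<close>, which turns \<open>u\<close> into \<open>v\<^sub>i\<close>, and multiplies the
  \<open>i\<close>-th exponential by its own unit (\<open>has_vector_derivative_oct_exp\<close>). Since \<open>v\<^sub>i\<close> is integrable, a
  multiple of its absolute value dominates the difference quotients, and so the derivative passes
  through the integral (\<open>has_vector_derivative_lebesgue_integral\<close>,
  \<open>has_vector_derivative_integral_angle\<close>).

  This leaves a unit in the middle of the product. Distinct imaginary units anticommute, so moving a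
  unit past an exponential of another unit reverses the angle of that exponential. Moved to the right
  end, the unit reverses the later angles and leaves the integral, which gives \<open>V\<^sub>i\<close> with a factor
  on the right (\<open>exp_unit_to_right\<close>). The transform of \<open>w\<^sub>i\<close> has the same unit at the left end, and
  moving it all the way to the right reverses the angles of both other exponentials
  (\<open>left_unit_to_right\<close>); the signs in the arguments of \<open>V\<^sub>i\<close> and \<open>W\<^sub>i\<close> record these reversals.
  As octonions do not associate, anticommutation alone does not justify moving a unit inside a
  product that involves all of the three units, and the moves are verified on coordinates.
\<close>

section \<open>Octonion exponentials\<close>

lemma bounded_bilinear_oct_mult: "bounded_bilinear (\<odot>)"
  unfolding bilinear_conv_bounded_bilinear[symmetric] bilinear_def
proof (intro conjI allI)
  show "linear (\<lambda>q. p \<odot> q)" for p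
    by (rule linearI; cases p) (auto simp: algebra_simps)
  show "linear (\<lambda>p. p \<odot> q)" for q
    by (rule linearI; cases q) (auto simp: algebra_simps)
qed

interpretation oct_mult: bounded_bilinear "(\<odot>)"
  by (rule bounded_bilinear_oct_mult)

lemmas oct_coords = oct_exp_def oct_of_real_def oct_unit_def quat_unit_def zero_prod_def

lemma oct_of_real_mult: "oct_of_real r \<odot> p = r *\<^sub>R p"
  by (cases p) (auto simp: oct_coords)

lemma oct_mult_one: "p \<odot> oct_unit 0 = p"
  by (cases p) (auto simp: oct_coords)

lemma norm_oct_unit: "k < 8 \<Longrightarrow> norm (oct_unit k) = 1"
  by (auto simp: oct_unit_def quat_unit_def norm_Pair)

lemma norm_oct_exp_le:
  assumes "k < 8"
  shows "norm (oct_exp k a) \<le> 2"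
proof -
  have "norm (oct_exp k a) \<le> \<bar>cos a\<bar> + \<bar>sin a\<bar>"
    using norm_triangle_ineq[of "cos a *\<^sub>R oct_unit 0" "sin a *\<^sub>R oct_unit k"] assms
    by (simp add: oct_exp_def oct_of_real_def norm_oct_unit)
  with abs_cos_le_one[of a] abs_sin_le_one[of a] show ?thesis by linarith
qed

lemma continuous_on_oct_exp [continuous_intros]:
  fixes g :: "'a::t2_space \<Rightarrow> real"
  assumes "continuous_on S g"
  shows "continuous_on S (\<lambda>x. oct_exp k (g x))"
  unfolding oct_exp_def oct_of_real_def using assms by (intro continuous_intros)

lemma oct_exp_mult_unit:
  assumes "k \<in> {1..<8}"
  shows "oct_exp k a \<odot> oct_unit k = cos a *\<^sub>R oct_unit k - sin a *\<^sub>R oct_unit 0"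
proof -
  have "k \<in> {1, 2, 3, 4, 5, 6, 7}" using assms by auto
  then show ?thesis by (auto simp: oct_coords)
qed

lemma has_vector_derivative_oct_exp:
  assumes "k \<in> {1..<8}"
  shows "(oct_exp k has_vector_derivative oct_exp k a \<odot> oct_unit k) (at a)"
  unfolding oct_exp_mult_unit[OF assms] unfolding oct_exp_def oct_of_real_def
  by (auto intro!: derivative_eq_intros)

definition oct_kernel :: "real \<Rightarrow> real \<Rightarrow> real \<Rightarrow> octonion" where
  "oct_kernel a b c = oct_exp 1 a \<odot> oct_exp 2 b \<odot> oct_exp 4 c"

text \<open>
  The left-hand sides are what the product rule yields for the three partial derivatives of the
  kernel: only the exponentials to the right of the unit have their angles reversed.
\<close>

lemma exp_unit_to_right:
  "oct_exp 1 a \<odot> oct_unit 1 \<odot> oct_exp 2 b \<odot> oct_exp 4 c = oct_kernel a (- b) (- c) \<odot> oct_unit 1"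
  "oct_exp 1 a \<odot> (oct_exp 2 b \<odot> oct_unit 2) \<odot> oct_exp 4 c = oct_kernel a b (- c) \<odot> oct_unit 2"
  "oct_exp 1 a \<odot> oct_exp 2 b \<odot> (oct_exp 4 c \<odot> oct_unit 4) = oct_kernel a b c \<odot> oct_unit 4"
  by (auto simp: oct_kernel_def oct_coords)

text \<open>
  The left-hand sides are the integrands of the transforms of the functions \<open>w\<^sub>i\<close>, up to a real factor.
\<close>

lemma left_unit_to_right:
  "oct_unit 1 \<odot> oct_exp 1 a \<odot> oct_exp 2 b \<odot> oct_exp 4 c = oct_kernel a (- b) (- c) \<odot> oct_unit 1"
  "oct_unit 2 \<odot> oct_exp 1 a \<odot> oct_exp 2 b \<odot> oct_exp 4 c = oct_kernel (- a) b (- c) \<odot> oct_unit 2"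
  "oct_unit 4 \<odot> oct_exp 1 a \<odot> oct_exp 2 b \<odot> oct_exp 4 c = oct_kernel (- a) (- b) c \<odot> oct_unit 4"
  by (auto simp: oct_kernel_def oct_coords)

lemma has_vector_derivative_oct_kernel:
  "((\<lambda>a. oct_kernel a b c) has_vector_derivative oct_kernel a (- b) (- c) \<odot> oct_unit 1) (at a)"
  "((\<lambda>b. oct_kernel a b c) has_vector_derivative oct_kernel a b (- c) \<odot> oct_unit 2) (at b)"
  "((\<lambda>c. oct_kernel a b c) has_vector_derivative oct_kernel a b c \<odot> oct_unit 4) (at c)"
proof -
  note const = has_vector_derivative_const and prod = oct_mult.has_vector_derivative
  have exp1: "(oct_exp 1 has_vector_derivative oct_exp 1 a \<odot> oct_unit 1) (at a)"
    and exp2: "(oct_exp 2 has_vector_derivative oct_exp 2 b \<odot> oct_unit 2) (at b)"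
    and exp4: "(oct_exp 4 has_vector_derivative oct_exp 4 c \<odot> oct_unit 4) (at c)"
    by (simp_all add: has_vector_derivative_oct_exp)
  show "((\<lambda>a. oct_kernel a b c) has_vector_derivative oct_kernel a (- b) (- c) \<odot> oct_unit 1) (at a)"
    using prod[OF prod[OF exp1 const[of "oct_exp 2 b"]] const[of "oct_exp 4 c"]]
    unfolding oct_mult.zero_left oct_mult.zero_right add_0_left exp_unit_to_right
    unfolding oct_kernel_def .
  show "((\<lambda>b. oct_kernel a b c) has_vector_derivative oct_kernel a b (- c) \<odot> oct_unit 2) (at b)"
    using prod[OF prod[OF const[of "oct_exp 1 a"] exp2] const[of "oct_exp 4 c"]]
    unfolding oct_mult.zero_left oct_mult.zero_right add_0_left add_0_right exp_unit_to_right
    unfolding oct_kernel_def .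
  show "((\<lambda>c. oct_kernel a b c) has_vector_derivative oct_kernel a b c \<odot> oct_unit 4) (at c)"
    using prod[OF const[of "oct_exp 1 a \<odot> oct_exp 2 b"] exp4]
    unfolding oct_mult.zero_left add_0_right exp_unit_to_right
    unfolding oct_kernel_def .
qed

lemma continuous_on_oct_kernel [continuous_intros]:
  fixes a b c :: "'a::t2_space \<Rightarrow> real"
  assumes "continuous_on S a" "continuous_on S b" "continuous_on S c"
  shows "continuous_on S (\<lambda>x. oct_kernel (a x) (b x) (c x))"
  unfolding oct_kernel_def using assms by (intro oct_mult.continuous_on continuous_intros)

text \<open>
  Any uniform bound serves for domination, so boundedness of the bilinear product is used instead of
  the multiplicativity of the octonion norm.
\<close>

lemma oct_kernel_mult_bounded: "\<exists>C. \<forall>a b c. norm (oct_kernel a b c \<odot> p) \<le> C"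
proof -
  obtain K where K: "K > 0" "\<And>p q. norm (p \<odot> q) \<le> norm p * norm q * K"
    using oct_mult.pos_bounded by blast
  have step: "norm (q \<odot> r) \<le> A * B * K" if "norm q \<le> A" "norm r \<le> B" for q r A B
  proof -
    have "norm q * norm r \<le> A * B"
      by (rule mult_mono) (use that order_trans[OF norm_ge_zero that(1)] in auto)
    with K show ?thesis by (meson less_imp_le mult_right_mono order_trans)
  qed
  have "norm (oct_kernel a b c \<odot> p) \<le> 2 * 2 * K * 2 * K * norm p * K" for a b c
    unfolding oct_kernel_def by (intro step norm_oct_exp_le order_refl) simp_all
  then show ?thesis by blast
qed

section \<open>Differentiation under the Lebesgue integral\<close>

lemma has_vector_derivative_iff_quotient:
  "(f has_vector_derivative D) (at t) \<longleftrightarrow> ((\<lambda>s. (f s - f t) /\<^sub>R (s - t)) \<longlongrightarrow> D) (at t)"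
proof -
  have "norm (f s - f t - (s - t) *\<^sub>R D) / norm (s - t) = norm ((f s - f t) /\<^sub>R (s - t) - D)"
    if "s \<noteq> t" for s
  proof -
    have "(f s - f t) /\<^sub>R (s - t) - D = (f s - f t - (s - t) *\<^sub>R D) /\<^sub>R (s - t)"
      using that by (simp add: scaleR_diff_right)
    then show ?thesis by (simp add: divide_inverse mult.commute)
  qed
  then have "((\<lambda>s. norm (f s - f t - (s - t) *\<^sub>R D) / norm (s - t)) \<longlongrightarrow> 0) (at t) \<longleftrightarrow>
      ((\<lambda>s. norm ((f s - f t) /\<^sub>R (s - t) - D)) \<longlongrightarrow> 0) (at t)"
    by (intro Lim_cong_within) auto
  then show ?thesis
    by (simp add: has_vector_derivative_def has_derivative_iff_norm bounded_linear_scaleR_left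
        tendsto_norm_zero_iff LIM_zero_iff)
qed

text \<open>
  By the mean value inequality a bound for the derivative also bounds every difference quotient, so
  dominated convergence applies along each sequence tending to the point.
\<close>

lemma has_vector_derivative_lebesgue_integral:
  fixes g g' :: "real \<Rightarrow> 'a \<Rightarrow> 'b::{banach, second_countable_topology}"
  assumes integrable: "\<And>t. integrable M (g t)"
    and deriv: "\<And>t x. ((\<lambda>t. g t x) has_vector_derivative g' t x) (at t)"
    and meas: "g' t \<in> borel_measurable M"
    and bound: "\<And>t x. norm (g' t x) \<le> B x"
    and B: "integrable M B"
  shows "((\<lambda>t. \<integral>x. g t x \<partial>M) has_vector_derivative (\<integral>x. g' t x \<partial>M)) (at t)"
  unfolding has_vector_derivative_iff_quotient tendsto_at_iff_sequentially comp_def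
proof (intro allI impI)
  fix X :: "nat \<Rightarrow> real"
  assume X: "\<forall>i. X i \<in> UNIV - {t}" and lim: "X \<longlonglongrightarrow> t"
  have "norm ((g s x - g t x) /\<^sub>R (s - t)) \<le> B x" if "s \<noteq> t" for s x
  proof -
    have "norm (g s x - g t x) \<le> B x * norm (s - t)"
    proof (rule differentiable_bound[where S = UNIV and f' = "\<lambda>t h. h *\<^sub>R g' t x"])
      show "((\<lambda>t. g t x) has_derivative (\<lambda>h. h *\<^sub>R g' r x)) (at r within UNIV)" for r
        using deriv[of x r] by (simp add: has_vector_derivative_def)
      show "onorm (\<lambda>h. h *\<^sub>R g' r x) \<le> B x" for r
        using mult_left_mono[OF bound[of r x]] by (intro onorm_le) (simp add: mult.commute[of "B x"])
    qed auto
    moreover have "norm ((g s x - g t x) /\<^sub>R (s - t)) = norm (g s x - g t x) / norm (s - t)"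
      by (simp add: divide_inverse mult.commute)
    ultimately show ?thesis using that by (simp add: pos_divide_le_eq)
  qed
  then have dom: "norm ((g (X n) x - g t x) /\<^sub>R (X n - t)) \<le> B x" for n x
    using X by auto
  have "(\<lambda>n. \<integral>x. (g (X n) x - g t x) /\<^sub>R (X n - t) \<partial>M) \<longlonglongrightarrow> (\<integral>x. g' t x \<partial>M)"
  proof (rule integral_dominated_convergence[OF meas _ B])
    show "(\<lambda>x. (g (X n) x - g t x) /\<^sub>R (X n - t)) \<in> borel_measurable M" for n
      using integrable[THEN borel_measurable_integrable] by measurable
    show "AE x in M. (\<lambda>n. (g (X n) x - g t x) /\<^sub>R (X n - t)) \<longlonglongrightarrow> g' t x"
      using deriv[of _ t] X lim
      unfolding has_vector_derivative_iff_quotient tendsto_at_iff_sequentially comp_def by blast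
  qed (use dom in auto)
  then show "(\<lambda>n. ((\<integral>x. g (X n) x \<partial>M) - (\<integral>x. g t x \<partial>M)) /\<^sub>R (X n - t)) \<longlonglongrightarrow> (\<integral>x. g' t x \<partial>M)"
    using integrable by simp
qed

lemma integrable_scaleR_continuous_bounded:
  fixes u :: "'a::euclidean_space \<Rightarrow> real" and g :: "'a \<Rightarrow> 'b::euclidean_space"
  assumes u: "integrable lebesgue u" and g: "continuous_on UNIV g" and C: "\<And>x. norm (g x) \<le> C"
  shows "integrable lebesgue (\<lambda>x. u x *\<^sub>R g x)"
proof (rule Bochner_Integration.integrable_bound)
  show "integrable lebesgue (\<lambda>x. C * u x)" using u by simp
  have "g \<in> borel_measurable lebesgue"
    using borel_measurable_continuous_onI[OF g] by (simp add: measurable_completion)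
  then show "(\<lambda>x. u x *\<^sub>R g x) \<in> borel_measurable lebesgue"
    using borel_measurable_integrable[OF u] by measurable
  show "AE x in lebesgue. norm (u x *\<^sub>R g x) \<le> norm (C * u x)"
  proof (rule AE_I2)
    fix x
    have "norm (g x) \<le> \<bar>C\<bar>" using C[of x] by linarith
    from mult_left_mono[OF this abs_ge_zero[of "u x"]]
    show "norm (u x *\<^sub>R g x) \<le> norm (C * u x)" by (simp add: abs_mult mult.commute)
  qed
qed

text \<open>
  One rule serves all three variables: \<open>\<phi> \<theta> x\<close> is the kernel at the point \<open>x\<close> as a function of the
  angle that varies, and \<open>y x\<close> is the rate at which this angle depends on the frequency.
\<close>

lemma has_vector_derivative_integral_angle:
  fixes u y :: "'a::euclidean_space \<Rightarrow> real" and \<phi> \<phi>' :: "real \<Rightarrow> 'a \<Rightarrow> 'b::euclidean_space"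
  assumes u: "integrable lebesgue u" and yu: "integrable lebesgue (\<lambda>x. y x * u x)"
    and deriv: "\<And>\<theta> x. ((\<lambda>\<theta>. \<phi> \<theta> x) has_vector_derivative \<phi>' \<theta> x) (at \<theta>)"
    and cont: "\<And>t. continuous_on UNIV (\<lambda>x. \<phi> (t * y x) x)"
      "\<And>t. continuous_on UNIV (\<lambda>x. \<phi>' (t * y x) x)"
    and bound: "\<And>\<theta> x. norm (\<phi> \<theta> x) \<le> C" "\<And>\<theta> x. norm (\<phi>' \<theta> x) \<le> C'"
  shows "((\<lambda>t. \<integral>x. u x *\<^sub>R \<phi> (t * y x) x \<partial>lebesgue) has_vector_derivative
      (\<integral>x. (y x * u x) *\<^sub>R \<phi>' (t * y x) x \<partial>lebesgue)) (at t)"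
proof (rule has_vector_derivative_lebesgue_integral)
  show "integrable lebesgue (\<lambda>x. u x *\<^sub>R \<phi> (t * y x) x)" for t
    using u cont(1) bound(1) by (rule integrable_scaleR_continuous_bounded)
  show "(\<lambda>x. (y x * u x) *\<^sub>R \<phi>' (t * y x) x) \<in> borel_measurable lebesgue"
    using integrable_scaleR_continuous_bounded[OF yu cont(2) bound(2)] by auto
  show "integrable lebesgue (\<lambda>x. C' * norm (y x * u x))"
    using yu by (intro integrable_mult_right integrable_norm)
  show "norm ((y x * u x) *\<^sub>R \<phi>' (t * y x) x) \<le> C' * norm (y x * u x)" for t x
    using mult_left_mono[OF bound(2)[of "t * y x" x], of "norm (y x * u x)"]
    by (simp add: mult.commute)
  show "((\<lambda>t. u x *\<^sub>R \<phi> (t * y x) x) has_vector_derivative (y x * u x) *\<^sub>R \<phi>' (t * y x) x) (at t)"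
    for t x
  proof -
    have "((\<lambda>t. t * y x) has_vector_derivative y x) (at t)"
      by (auto intro!: derivative_eq_intros)
    from vector_diff_chain_at[OF this deriv]
    have "((\<lambda>t. \<phi> (t * y x) x) has_vector_derivative y x *\<^sub>R \<phi>' (t * y x) x) (at t)"
      by (simp add: comp_def)
    from bounded_linear.has_vector_derivative[OF bounded_linear_scaleR_right this, of "u x"]
    show ?thesis by (simp add: mult.commute)
  qed
qed

section \<open>Transforms of real functions\<close>

text \<open>
  The angles are written as frequency times rate, the form in which the integrand is differentiated.
\<close>

lemma oft_of_real:
  "oft (\<lambda>x. oct_of_real (u x)) f =
    (\<integral>x. u x *\<^sub>R oct_kernel (f $ 1 * (- 2 * pi * x $ 1)) (f $ 2 * (- 2 * pi * x $ 2))
      (f $ 3 * (- 2 * pi * x $ 3)) \<partial>lebesgue)"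
  by (simp add: oft_def oct_kernel_def oct_of_real_mult oct_mult.scaleR_left mult_ac)

lemma oft_of_real_mult_unit:
  "oft (\<lambda>x. oct_of_real (u x) \<odot> p) f =
    (\<integral>x. u x *\<^sub>R (p \<odot> oct_exp 1 (f $ 1 * (- 2 * pi * x $ 1)) \<odot> oct_exp 2 (f $ 2 * (- 2 * pi * x $ 2))
      \<odot> oct_exp 4 (f $ 3 * (- 2 * pi * x $ 3))) \<partial>lebesgue)"
  by (simp add: oft_def oct_of_real_mult oct_mult.scaleR_left mult_ac)

lemma oft_of_real_mult_right:
  assumes "integrable lebesgue u"
  shows "oft (\<lambda>x. oct_of_real (u x)) f \<odot> p =
    (\<integral>x. u x *\<^sub>R (oct_kernel (f $ 1 * (- 2 * pi * x $ 1)) (f $ 2 * (- 2 * pi * x $ 2))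
      (f $ 3 * (- 2 * pi * x $ 3)) \<odot> p) \<partial>lebesgue)"
proof -
  obtain C where C: "\<And>a b c. norm (oct_kernel a b c) \<le> C"
    using oct_kernel_mult_bounded[of "oct_unit 0"] unfolding oct_mult_one by blast
  have "integrable lebesgue (\<lambda>x. u x *\<^sub>R oct_kernel (f $ 1 * (- 2 * pi * x $ 1))
      (f $ 2 * (- 2 * pi * x $ 2)) (f $ 3 * (- 2 * pi * x $ 3)))"
    by (rule integrable_scaleR_continuous_bounded[OF assms _ C])
      (intro continuous_intros)
  from integral_bounded_linear[OF oct_mult.bounded_linear_left this, of p]
  show ?thesis by (simp add: oft_of_real oct_mult.scaleR_left)
qed

theorem theorem15:
  fixes u :: "real ^ 3 \<Rightarrow> real"
    and v :: "nat \<Rightarrow> real ^ 3 \<Rightarrow> real"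
    and w :: "nat \<Rightarrow> real ^ 3 \<Rightarrow> octonion"
    and U :: "real ^ 3 \<Rightarrow> octonion"
    and V W :: "nat \<Rightarrow> real ^ 3 \<Rightarrow> octonion"
    and f1 f2 f3 :: real
  assumes v_def: "\<And>i x. i \<in> {1, 2, 3} \<Longrightarrow> v i x = - 2 * pi * x $ of_nat i * u x"
    and w_def: "\<And>i x. i \<in> {1, 2, 3} \<Longrightarrow> w i x = oct_of_real (v i x) \<odot> oct_unit (2 ^ (i - 1))"
    and U_def: "U = oft (\<lambda>x. oct_of_real (u x))"
    and V_def: "\<And>i. i \<in> {1, 2, 3} \<Longrightarrow> V i = oft (\<lambda>x. oct_of_real (v i x))"
    and W_def: "\<And>i. i \<in> {1, 2, 3} \<Longrightarrow> W i = oft (w i)"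
    and u_integrable: "integrable lebesgue u"
    and v_integrable: "\<And>i. i \<in> {1, 2, 3} \<Longrightarrow> integrable lebesgue (v i)"
  shows "((\<lambda>t. U (vector [t, f2, f3])) has_vector_derivative
            V 1 (vector [f1, - f2, - f3]) \<odot> oct_unit 1) (at f1)
       \<and> V 1 (vector [f1, - f2, - f3]) \<odot> oct_unit 1 = W 1 (vector [f1, f2, f3])
       \<and> ((\<lambda>t. U (vector [f1, t, f3])) has_vector_derivative
            V 2 (vector [f1, f2, - f3]) \<odot> oct_unit 2) (at f2)
       \<and> V 2 (vector [f1, f2, - f3]) \<odot> oct_unit 2 = W 2 (vector [- f1, f2, f3])
       \<and> ((\<lambda>t. U (vector [f1, f2, t])) has_vector_derivative
            V 3 (vector [f1, f2, f3]) \<odot> oct_unit 4) (at f3)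
       \<and> V 3 (vector [f1, f2, f3]) \<odot> oct_unit 4 = W 3 (vector [- f1, - f2, f3])"
proof -
  obtain C where C: "\<And>a b c. norm (oct_kernel a b c) \<le> C"
    using oct_kernel_mult_bounded[of "oct_unit 0"] unfolding oct_mult_one by blast
  obtain C1 where C1: "\<And>a b c. norm (oct_kernel a b c \<odot> oct_unit 1) \<le> C1"
    using oct_kernel_mult_bounded by blast
  obtain C2 where C2: "\<And>a b c. norm (oct_kernel a b c \<odot> oct_unit 2) \<le> C2"
    using oct_kernel_mult_bounded by blast
  obtain C4 where C4: "\<And>a b c. norm (oct_kernel a b c \<odot> oct_unit 4) \<le> C4"
    using oct_kernel_mult_bounded by blast
  note cont = continuous_intros oct_mult.continuous_on
  have v: "v 1 = (\<lambda>x. - 2 * pi * x $ 1 * u x)" "v 2 = (\<lambda>x. - 2 * pi * x $ 2 * u x)"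
    "v 3 = (\<lambda>x. - 2 * pi * x $ 3 * u x)"
    using v_def by (auto simp: fun_eq_iff)
  have vint: "integrable lebesgue (v 1)" "integrable lebesgue (v 2)" "integrable lebesgue (v 3)"
    using v_integrable by auto
  have Ve: "V i f \<odot> p = (\<integral>x. v i x *\<^sub>R (oct_kernel (f $ 1 * (- 2 * pi * x $ 1))
      (f $ 2 * (- 2 * pi * x $ 2)) (f $ 3 * (- 2 * pi * x $ 3)) \<odot> p) \<partial>lebesgue)"
    if "i \<in> {1, 2, 3}" for i f p
    unfolding V_def[OF that] by (rule oft_of_real_mult_right[OF v_integrable[OF that]])
  have W: "W i f = (\<integral>x. v i x *\<^sub>R (oct_unit (2 ^ (i - 1)) \<odot> oct_exp 1 (f $ 1 * (- 2 * pi * x $ 1))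
      \<odot> oct_exp 2 (f $ 2 * (- 2 * pi * x $ 2)) \<odot> oct_exp 4 (f $ 3 * (- 2 * pi * x $ 3))) \<partial>lebesgue)"
    if "i \<in> {1, 2, 3}" for i f
    unfolding W_def[OF that] w_def[OF that, abs_def] by (rule oft_of_real_mult_unit)

  have VW1: "V 1 (vector [f1, - f2, - f3]) \<odot> oct_unit 1 = W 1 (vector [f1, f2, f3])"
    using Ve[of 1 "vector [f1, - f2, - f3]"] W[of 1 "vector [f1, f2, f3]"]
    by (simp add: left_unit_to_right del: One_nat_def)
  have VW2: "V 2 (vector [f1, f2, - f3]) \<odot> oct_unit 2 = W 2 (vector [- f1, f2, f3])"
    using Ve[of 2 "vector [f1, f2, - f3]"] W[of 2 "vector [- f1, f2, f3]"]
    by (simp add: left_unit_to_right del: One_nat_def)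
  have VW3: "V 3 (vector [f1, f2, f3]) \<odot> oct_unit 4 = W 3 (vector [- f1, - f2, f3])"
    using Ve[of 3 "vector [f1, f2, f3]"] W[of 3 "vector [- f1, - f2, f3]"]
    by (simp add: left_unit_to_right del: One_nat_def)

  have D1: "((\<lambda>t. U (vector [t, f2, f3])) has_vector_derivative
      V 1 (vector [f1, - f2, - f3]) \<odot> oct_unit 1) (at f1)"
  proof -
    have "((\<lambda>t. \<integral>x. u x *\<^sub>R oct_kernel (t * (- 2 * pi * x $ 1)) (f2 * (- 2 * pi * x $ 2))
          (f3 * (- 2 * pi * x $ 3)) \<partial>lebesgue)
        has_vector_derivative (\<integral>x. (- 2 * pi * x $ 1 * u x) *\<^sub>R
          (oct_kernel (f1 * (- 2 * pi * x $ 1)) (- (f2 * (- 2 * pi * x $ 2)))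
            (- (f3 * (- 2 * pi * x $ 3))) \<odot> oct_unit 1) \<partial>lebesgue)) (at f1)"
      by (rule has_vector_derivative_integral_angle[OF u_integrable vint(1)[unfolded v]
            has_vector_derivative_oct_kernel(1) _ _ C C1])
        (intro cont)+
    then show ?thesis by (simp add: Ve U_def oft_of_real v del: One_nat_def)
  qed
  have D2: "((\<lambda>t. U (vector [f1, t, f3])) has_vector_derivative
      V 2 (vector [f1, f2, - f3]) \<odot> oct_unit 2) (at f2)"
  proof -
    have "((\<lambda>t. \<integral>x. u x *\<^sub>R oct_kernel (f1 * (- 2 * pi * x $ 1)) (t * (- 2 * pi * x $ 2))
          (f3 * (- 2 * pi * x $ 3)) \<partial>lebesgue)
        has_vector_derivative (\<integral>x. (- 2 * pi * x $ 2 * u x) *\<^sub>R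
          (oct_kernel (f1 * (- 2 * pi * x $ 1)) (f2 * (- 2 * pi * x $ 2))
            (- (f3 * (- 2 * pi * x $ 3))) \<odot> oct_unit 2) \<partial>lebesgue)) (at f2)"
      by (rule has_vector_derivative_integral_angle[OF u_integrable vint(2)[unfolded v]
            has_vector_derivative_oct_kernel(2) _ _ C C2])
        (intro cont)+
    then show ?thesis by (simp add: Ve U_def oft_of_real v del: One_nat_def)
  qed
  have D3: "((\<lambda>t. U (vector [f1, f2, t])) has_vector_derivative
      V 3 (vector [f1, f2, f3]) \<odot> oct_unit 4) (at f3)"
  proof -
    have "((\<lambda>t. \<integral>x. u x *\<^sub>R oct_kernel (f1 * (- 2 * pi * x $ 1)) (f2 * (- 2 * pi * x $ 2))
          (t * (- 2 * pi * x $ 3)) \<partial>lebesgue)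
        has_vector_derivative (\<integral>x. (- 2 * pi * x $ 3 * u x) *\<^sub>R
          (oct_kernel (f1 * (- 2 * pi * x $ 1)) (f2 * (- 2 * pi * x $ 2))
            (f3 * (- 2 * pi * x $ 3)) \<odot> oct_unit 4) \<partial>lebesgue)) (at f3)"
      by (rule has_vector_derivative_integral_angle[OF u_integrable vint(3)[unfolded v]
            has_vector_derivative_oct_kernel(3) _ _ C C4])
        (intro cont)+
    then show ?thesis by (simp add: Ve U_def oft_of_real v del: One_nat_def)
  qed
  show ?thesis using D1 VW1 D2 VW2 D3 VW3 by blast
qed

end
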